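(* Let $n\ge 1$ and let $p_1,\ldots,p_n\in[0,1]$. Let $X_1,\ldots,X_n$ and $\tilde X_1,\ldots,\tilde X_n$ be two collections of Bernoulli random variables such that $X_i\sim\mathrm{Bernoulli}(p_i)$ and $\tilde X_i\sim\mathrm{Bernoulli}(p_i)$ for each $i$, and the $\tilde X_i$ are mutually independent (and independent of the $X_i$). Assume that the $X_i$ are pairwise independent, and put $Z=\sum_{i=1}^n X_i$ and $\tilde Z=\sum_{i=1}^n\tilde X_i$. Then $$\mathbb{P}(Z>0)\ \ge\ \frac12\,\mathbb{P}(\tilde Z>0).$$
   Context: For Bernoulli ($\{0,1\}$-valued) random variables, pairwise independence means $\mathbb{E}[X_iX_j]=\mathbb{E}[X_i]\,\mathbb{E}[X_j]$ for all $i\ne j$. *)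

theory Defs
  imports "HOL-Probability.Probability"
begin

(* bernoulli_pmf lives on bool; its image under of_bool is the Bernoulli law on {0,1} as a
   subset of the reals. As a condition on the law, the definition forces X to take
   values in {0,1} almost surely rather than at every point of the space. *)
definition bernoulli_rv :: "'a measure \<Rightarrow> real \<Rightarrow> ('a \<Rightarrow> real) \<Rightarrow> bool" where
  "bernoulli_rv M p X \<longleftrightarrow>
     X \<in> borel_measurable M \<and>
     distr M borel X = distr (measure_pmf (bernoulli_pmf p)) borel of_bool"

end

theory Submission
  imports Defs
begin

text \<open>
  With \<open>S = \<Sum>i. p i\<close>, the union bound gives \<open>P(Zt > 0) \<le> min 1 S\<close>, whereas pairwise
  independence bounds the second moment of \<open>Z\<close> by \<open>S\<^sup>2 + S\<close>, so that the second moment method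
  gives \<open>P(Z > 0) \<ge> S / (S + 1) \<ge> min 1 S / 2\<close>.
\<close>

text \<open>The Bernoulli law is carried by {0, 1}, and an almost sure property of a value depends
  only on its law. This yields the bound by 1 behind the integrability of each \<open>X\<close> and
  of products of two of them.\<close>

lemma bernoulli_rv_AE:
  assumes "bernoulli_rv M p X"
  shows "AE \<omega> in M. X \<omega> \<in> {0, 1}"
proof -
  have X: "X \<in> borel_measurable M"
    and d: "distr M borel X = distr (measure_pmf (bernoulli_pmf p)) borel of_bool"
    using assms by (auto simp: bernoulli_rv_def)
  have "AE x in distr (measure_pmf (bernoulli_pmf p)) borel of_bool. x \<in> {0, 1 :: real}"
    by (subst AE_distr_iff) auto
  then show ?thesis
    unfolding d [symmetric] using X by (subst (asm) AE_distr_iff) auto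
qed

text \<open>Change of variables twice: both sides integrate \<open>f\<close> against the common law.
  Taking \<open>f\<close> as an indicator, the identity and the square gives every single-variable
  quantity used below.\<close>

lemma bernoulli_rv_integral:
  fixes f :: "real \<Rightarrow> real"
  assumes "bernoulli_rv M p X" "p \<in> {0..1}" and [measurable]: "f \<in> borel_measurable borel"
  shows "(\<integral>\<omega>. f (X \<omega>) \<partial>M) = f 1 * p + f 0 * (1 - p)"
proof -
  have X: "X \<in> borel_measurable M"
    and d: "distr M borel X = distr (measure_pmf (bernoulli_pmf p)) borel of_bool"
    using assms by (auto simp: bernoulli_rv_def)
  have "(\<integral>\<omega>. f (X \<omega>) \<partial>M) = (\<integral>x. f x \<partial>distr M borel X)"
    using X by (simp add: integral_distr)
  also have "\<dots> = (\<integral>b. f (of_bool b) \<partial>measure_pmf (bernoulli_pmf p))"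
    unfolding d by (subst integral_distr) auto
  also have "\<dots> = f 1 * p + f 0 * (1 - p)"
    using assms(2) by simp
  finally show ?thesis .
qed

context prob_space
begin

lemma bernoulli_rv_prob_pos:
  assumes "bernoulli_rv M p X" "p \<in> {0..1}"
  shows "\<P>(\<omega> in M. X \<omega> > 0) = p"
proof -
  have [measurable]: "X \<in> borel_measurable M"
    using assms by (auto simp: bernoulli_rv_def)
  have "\<P>(\<omega> in M. X \<omega> > 0) = expectation (indicator {\<omega> \<in> space M. X \<omega> > 0})"
    by simp
  \<comment> \<open>The indicator of the event is written as a function of the value
    \<open>X \<omega>\<close>, so that only the law matters.\<close>
  also have "\<dots> = (\<integral>\<omega>. indicator {0<..} (X \<omega>) \<partial>M)"
    by (intro Bochner_Integration.integral_cong) (auto simp: indicator_def)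
  finally show ?thesis
    using bernoulli_rv_integral [OF assms, of "indicator {0<..}"] by simp
qed

lemma integrable_bernoulli_rv:
  assumes "bernoulli_rv M p X"
  shows "integrable M X"
proof (rule integrable_const_bound [where B = 1])
  show "AE \<omega> in M. norm (X \<omega>) \<le> 1"
    using bernoulli_rv_AE [OF assms] by eventually_elim auto
qed (use assms in \<open>auto simp: bernoulli_rv_def\<close>)

lemma integrable_bernoulli_rv_mult:
  assumes "bernoulli_rv M p X" "bernoulli_rv M q Y"
  shows "integrable M (\<lambda>\<omega>. X \<omega> * Y \<omega>)"
proof (rule integrable_const_bound [where B = 1])
  show "AE \<omega> in M. norm (X \<omega> * Y \<omega>) \<le> 1"
    using bernoulli_rv_AE [OF assms(1)] bernoulli_rv_AE [OF assms(2)]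
    by eventually_elim auto
qed (use assms in \<open>auto simp: bernoulli_rv_def\<close>)

text \<open>A positive sum has at least one positive summand, so the event lies in a finite union
  and subadditivity applies.\<close>

lemma prob_sum_pos_le:
  fixes Y :: "'i \<Rightarrow> 'a \<Rightarrow> real"
  assumes I: "finite I" and [measurable]: "\<And>i. i \<in> I \<Longrightarrow> Y i \<in> borel_measurable M"
  shows "\<P>(\<omega> in M. (\<Sum>i\<in>I. Y i \<omega>) > 0) \<le> (\<Sum>i\<in>I. \<P>(\<omega> in M. Y i \<omega> > 0))"
proof -
  have "\<P>(\<omega> in M. (\<Sum>i\<in>I. Y i \<omega>) > 0) \<le> prob (\<Union>i\<in>I. {\<omega> \<in> space M. Y i \<omega> > 0})"
  proof (rule finite_measure_mono)
    show "{\<omega> \<in> space M. (\<Sum>i\<in>I. Y i \<omega>) > 0} \<subseteq> (\<Union>i\<in>I. {\<omega> \<in> space M. Y i \<omega> > 0})"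
    proof
      fix \<omega> assume \<omega>: "\<omega> \<in> {\<omega> \<in> space M. (\<Sum>i\<in>I. Y i \<omega>) > 0}"
      then have "\<not> (\<forall>i\<in>I. Y i \<omega> \<le> 0)"
        using sum_nonpos [of I "\<lambda>i. Y i \<omega>"] by auto
      then show "\<omega> \<in> (\<Union>i\<in>I. {\<omega> \<in> space M. Y i \<omega> > 0})"
        using \<omega> by (auto simp: not_le)
    qed
    show "(\<Union>i\<in>I. {\<omega> \<in> space M. Y i \<omega> > 0}) \<in> events"
      using I by (intro sets.finite_UN) auto
  qed
  also have "\<dots> \<le> (\<Sum>i\<in>I. \<P>(\<omega> in M. Y i \<omega> > 0))"
    using I by (intro finite_measure_subadditive_finite) auto
  finally show ?thesis .
qed

text \<open>
  A linearised Paley--Zygmund inequality: \<open>c = E Z / E Z\<^sup>2\<close> would be optimal, but leaving \<open>c\<close> free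
  avoids both Cauchy--Schwarz and the division by zero.
\<close>
lemma prob_pos_ge_moments:
  fixes Z :: "'a \<Rightarrow> real"
  assumes "integrable M Z" "integrable M (\<lambda>\<omega>. (Z \<omega>)\<^sup>2)" "c \<ge> 0"
  shows "\<P>(\<omega> in M. Z \<omega> > 0) \<ge> 2 * c * expectation Z - c\<^sup>2 * expectation (\<lambda>\<omega>. (Z \<omega>)\<^sup>2)"
proof -
  have [measurable]: "Z \<in> borel_measurable M"
    using assms by auto
  have "2 * c * expectation Z - c\<^sup>2 * expectation (\<lambda>\<omega>. (Z \<omega>)\<^sup>2)
      = expectation (\<lambda>\<omega>. 2 * c * Z \<omega> - c\<^sup>2 * (Z \<omega>)\<^sup>2)"
    using assms by simp
  also have "\<dots> \<le> expectation (indicator {\<omega> \<in> space M. Z \<omega> > 0})"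
  proof (rule integral_mono)
    fix \<omega> assume "\<omega> \<in> space M"
    \<comment> \<open>With z the value of \<open>Z\<close>, the integrand is 1 - (1 - c z)^2, a
      parabola in z that never exceeds 1. For z \<le> 0 both of its terms are nonpositive because c
      \<ge> 0. Hence it lies below the indicator of z > 0.\<close>
    have "0 \<le> (1 - c * Z \<omega>)\<^sup>2"
      by simp
    then have le1: "2 * c * Z \<omega> - c\<^sup>2 * (Z \<omega>)\<^sup>2 \<le> 1"
      by (simp add: power2_eq_square algebra_simps)
    have "2 * c * Z \<omega> - c\<^sup>2 * (Z \<omega>)\<^sup>2 \<le> 0" if "Z \<omega> \<le> 0"
    proof -
      have "c * Z \<omega> \<le> 0"
        using that assms(3) by (simp add: mult_nonneg_nonpos)
      moreover have "0 \<le> c\<^sup>2 * (Z \<omega>)\<^sup>2"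
        by simp
      ultimately show ?thesis
        by linarith
    qed
    then show "2 * c * Z \<omega> - c\<^sup>2 * (Z \<omega>)\<^sup>2 \<le> indicator {\<omega> \<in> space M. Z \<omega> > 0} \<omega>"
      using le1 \<open>\<omega> \<in> space M\<close> by (auto simp: indicator_def)
  qed (use assms in \<open>auto simp: less_top [symmetric]\<close>)
  finally show ?thesis
    by simp
qed

text \<open>The second moment of the sum involves only pairs of variables, so pairwise independence
  controls it completely; the first two moments then bound the probability from below.\<close>

lemma pairwise_indep_bernoulli_sum_pos:
  fixes X :: "'i \<Rightarrow> 'a \<Rightarrow> real"
  assumes I: "finite I" and p: "\<And>i. i \<in> I \<Longrightarrow> p i \<in> {0..1}"
    and X: "\<And>i. i \<in> I \<Longrightarrow> bernoulli_rv M (p i) (X i)"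
    and pw: "\<And>i j. i \<in> I \<Longrightarrow> j \<in> I \<Longrightarrow> i \<noteq> j \<Longrightarrow>
      expectation (\<lambda>\<omega>. X i \<omega> * X j \<omega>) = expectation (X i) * expectation (X j)"
  shows "\<P>(\<omega> in M. (\<Sum>i\<in>I. X i \<omega>) > 0) \<ge> (\<Sum>i\<in>I. p i) / ((\<Sum>i\<in>I. p i) + 1)"
proof -
  define S where "S = (\<Sum>i\<in>I. p i)"
  have S0: "S \<ge> 0"
    unfolding S_def using p by (intro sum_nonneg) auto
  have EX: "expectation (X i) = p i" if "i \<in> I" for i
    using bernoulli_rv_integral [OF X [OF that] p [OF that], of "\<lambda>x. x"] by simp
  \<comment> \<open>Off the diagonal this is an equality. On it the expectation is just
    \<open>p i\<close>, and the slack \<open>p i * p i\<close> is allowed so that the double sum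
    factors into \<open>S\<^sup>2 + S\<close>.\<close>
  have EXX: "expectation (\<lambda>\<omega>. X i \<omega> * X j \<omega>) \<le> p i * p j + (if i = j then p i else 0)"
    if "i \<in> I" "j \<in> I" for i j
  proof (cases "i = j")
    case True
    then show ?thesis
      using bernoulli_rv_integral [OF X [OF that(1)] p [OF that(1)], of "\<lambda>x. x * x"] by simp
  next
    case False
    then show ?thesis
      using pw [OF that] EX that by simp
  qed
  have int1: "integrable M (X i)" if "i \<in> I" for i
    using integrable_bernoulli_rv [OF X [OF that]] .
  have int2: "integrable M (\<lambda>\<omega>. X i \<omega> * X j \<omega>)" if "i \<in> I" "j \<in> I" for i j
    using integrable_bernoulli_rv_mult [OF X X] that by blast
  have sq: "(\<Sum>i\<in>I. X i \<omega>)\<^sup>2 = (\<Sum>i\<in>I. \<Sum>j\<in>I. X i \<omega> * X j \<omega>)" for \<omega>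
    by (simp add: power2_eq_square sum_product)
  have EZ: "expectation (\<lambda>\<omega>. \<Sum>i\<in>I. X i \<omega>) = S"
    using int1 EX by (simp add: S_def)
  have EZ2: "expectation (\<lambda>\<omega>. (\<Sum>i\<in>I. X i \<omega>)\<^sup>2) \<le> S\<^sup>2 + S"
  proof -
    have "expectation (\<lambda>\<omega>. (\<Sum>i\<in>I. X i \<omega>)\<^sup>2)
        = (\<Sum>i\<in>I. \<Sum>j\<in>I. expectation (\<lambda>\<omega>. X i \<omega> * X j \<omega>))"
      unfolding sq using int2 by simp
    also have "\<dots> \<le> (\<Sum>i\<in>I. \<Sum>j\<in>I. p i * p j + (if i = j then p i else 0))"
      by (intro sum_mono EXX)
    also have "\<dots> = S\<^sup>2 + S"
      using I by (simp add: S_def sum.distrib power2_eq_square sum_product)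
    finally show ?thesis .
  qed
  have intZ: "integrable M (\<lambda>\<omega>. \<Sum>i\<in>I. X i \<omega>)"
    "integrable M (\<lambda>\<omega>. (\<Sum>i\<in>I. X i \<omega>)\<^sup>2)"
    unfolding sq using int1 int2 by auto
  \<comment> \<open>The choice c = 1 / (S + 1) maximises 2 c S - c^2 (S^2 + S) when S > 0, and it
    still makes sense when S = 0.\<close>
  have "2 * (1 / (S + 1)) * S - (1 / (S + 1))\<^sup>2 * (S\<^sup>2 + S)
      \<le> 2 * (1 / (S + 1)) * S
        - (1 / (S + 1))\<^sup>2 * expectation (\<lambda>\<omega>. (\<Sum>i\<in>I. X i \<omega>)\<^sup>2)"
    by (intro diff_left_mono mult_left_mono EZ2) auto
  also have "\<dots> \<le> \<P>(\<omega> in M. (\<Sum>i\<in>I. X i \<omega>) > 0)"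
    using prob_pos_ge_moments [OF intZ, of "1 / (S + 1)"] S0 unfolding EZ by simp
  finally have "2 * (1 / (S + 1)) * S - (1 / (S + 1))\<^sup>2 * (S\<^sup>2 + S)
      \<le> \<P>(\<omega> in M. (\<Sum>i\<in>I. X i \<omega>) > 0)" .
  moreover have "2 * (1 / (S + 1)) * S - (1 / (S + 1))\<^sup>2 * (S\<^sup>2 + S) = S / (S + 1)"
    using S0 by (simp add: divide_simps power2_eq_square) (simp add: algebra_simps)
  ultimately show ?thesis
    by (simp add: S_def)
qed

end

theorem proposition2:
  fixes M :: "'a measure"
    and n :: nat
    and p :: "nat \<Rightarrow> real"
    and X Xt :: "nat \<Rightarrow> 'a \<Rightarrow> real"
  assumes "prob_space M"
    and "n \<ge> 1"
    and "\<And>i. i \<in> {1..n} \<Longrightarrow> p i \<in> {0..1}"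
    and "\<And>i. i \<in> {1..n} \<Longrightarrow> bernoulli_rv M (p i) (X i)"
    and "\<And>i. i \<in> {1..n} \<Longrightarrow> bernoulli_rv M (p i) (Xt i)"
    and "prob_space.indep_vars M (\<lambda>_. borel) Xt {1..n}"
    and "prob_space.indep_var M
           (PiM {1..n} (\<lambda>_. borel)) (\<lambda>\<omega>. \<lambda>i\<in>{1..n}. Xt i \<omega>)
           (PiM {1..n} (\<lambda>_. borel)) (\<lambda>\<omega>. \<lambda>i\<in>{1..n}. X i \<omega>)"
    and "\<And>i j. \<lbrakk>i \<in> {1..n}; j \<in> {1..n}; i \<noteq> j\<rbrakk> \<Longrightarrow>
           (\<integral>\<omega>. X i \<omega> * X j \<omega> \<partial>M) = (\<integral>\<omega>. X i \<omega> \<partial>M) * (\<integral>\<omega>. X j \<omega> \<partial>M)"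
  shows "\<P>(\<omega> in M. (\<Sum>i=1..n. X i \<omega>) > 0) \<ge> 1 / 2 * \<P>(\<omega> in M. (\<Sum>i=1..n. Xt i \<omega>) > 0)"
proof -
  interpret prob_space M by fact
  define S where "S = (\<Sum>i=1..n. p i)"
  have S0: "S \<ge> 0"
    unfolding S_def using assms(3) by (intro sum_nonneg) auto
  have "\<P>(\<omega> in M. (\<Sum>i=1..n. Xt i \<omega>) > 0) \<le> (\<Sum>i=1..n. \<P>(\<omega> in M. Xt i \<omega> > 0))"
    using assms(5) by (intro prob_sum_pos_le) (auto simp: bernoulli_rv_def)
  also have "\<dots> = S"
    unfolding S_def using bernoulli_rv_prob_pos assms(3,5) by (intro sum.cong) auto
  \<comment> \<open>The union bound is combined with the trivial bound of a probability by
    1.\<close>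
  finally have "\<P>(\<omega> in M. (\<Sum>i=1..n. Xt i \<omega>) > 0) \<le> min 1 S"
    by simp
  \<comment> \<open>If S \<le> 1, the denominator S + 1 is at most 2; if S > 1, then S / (S + 1)
    exceeds 1/2. Equality holds at S = 0 and S = 1.\<close>
  moreover have "1 / 2 * min 1 S \<le> S / (S + 1)"
  proof (cases "S \<le> 1")
    case True
    then have "S / 2 \<le> S / (S + 1)"
      using S0 by (intro divide_left_mono) auto
    then show ?thesis
      using True by simp
  next
    case False
    then show ?thesis
      by (simp add: field_simps)
  qed
  moreover have "S / (S + 1) \<le> \<P>(\<omega> in M. (\<Sum>i=1..n. X i \<omega>) > 0)"
    unfolding S_def using assms(3,4,8) by (intro pairwise_indep_bernoulli_sum_pos) auto
  ultimately show ?thesis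
    by linarith
qed

end
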